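(* Let $a,b,n\ge1$ be integers. The Horadam cube $\Pi^{a,b}_n$ contains a Hamiltonian path. If, moreover, $n>2$ and the number of vertices of $\Pi^{a,b}_n$ is even, then $\Pi^{a,b}_n$ is Hamiltonian.
   Context: For integers $a,b\ge1$ and $n\ge 0$, $\mathcal S^{a,b}_n$ is the set of all strings of length $n$ over the alphabet $\{0,1,\dots,a+b-1\}$ in which every letter from $\{a,\dots,a+b-1\}$ appears only immediately after a letter $0$. The Horadam cube $\Pi^{a,b}_n$ is the simple graph with vertex set $\mathcal S^{a,b}_n$ in which $x_1\cdots x_n$ and $y_1\cdots y_n$ are adjacent if and only if $\sum_{i=1}^n|x_i-y_i|=1$. A Hamiltonian path is a path visiting each vertex exactly once; a graph is Hamiltonian if it contains a cycle visiting each vertex exactly once. *)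

theory Defs
  imports "Graph_Theory.Graph_Theory"
begin

definition horadam_strings :: "nat \<Rightarrow> nat \<Rightarrow> nat \<Rightarrow> nat list set" where
  "horadam_strings a b n =
     {x. length x = n \<and> (\<forall>i<n. x ! i < a + b) \<and>
         (\<forall>i<n. a \<le> x ! i \<longrightarrow> 0 < i \<and> x ! (i - 1) = 0)}"

text \<open>Simple graphs are modelled, as in the AFP graph library, as finite symmetric loop-free digraphs
  whose arcs are pairs of vertices: an edge is a pair of opposite arcs.\<close>

definition horadam_cube :: "nat \<Rightarrow> nat \<Rightarrow> nat \<Rightarrow> nat list pair_pre_digraph" where
  "horadam_cube a b n =
     \<lparr> pverts = horadam_strings a b n,
       parcs = {(x, y). x \<in> horadam_strings a b n \<and> y \<in> horadam_strings a b n \<and>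
                        (\<Sum>i<n. \<bar>int (x ! i) - int (y ! i)\<bar>) = 1} \<rparr>"

definition hamiltonian_path :: "('a, 'b) pre_digraph \<Rightarrow> 'a \<Rightarrow> 'b awalk \<Rightarrow> 'a \<Rightarrow> bool" where
  "hamiltonian_path G u p v \<longleftrightarrow>
     pre_digraph.apath G u p v \<and> set (pre_digraph.awalk_verts G u p) = verts G"

text \<open>In a symmetric digraph the library notion of a cycle also admits the closed walk that
  traverses one edge back and forth; the bound on the length excludes it.\<close>

definition hamiltonian :: "('a, 'b) pre_digraph \<Rightarrow> bool" where
  "hamiltonian G \<longleftrightarrow>
     (\<exists>p. pre_digraph.cycle G p \<and> 3 \<le> length p \<and> tail G ` set p = verts G)"

lemma finite_horadam_strings: "finite (horadam_strings a b n)"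
proof (rule finite_subset)
  show "horadam_strings a b n \<subseteq> {x. set x \<subseteq> {..<a + b} \<and> length x = n}"
    by (auto simp: horadam_strings_def in_set_conv_nth)
  show "finite {x. set x \<subseteq> {..<a + b} \<and> length x = n}"
    by (rule finite_lists_length_eq) simp
qed

lemma pair_graph_horadam_cube: "pair_graph (horadam_cube a b n)"
proof
  show "finite (parcs (horadam_cube a b n))"
    by (rule finite_subset[of _ "horadam_strings a b n \<times> horadam_strings a b n"])
      (auto simp: horadam_cube_def finite_horadam_strings)
qed (auto simp: horadam_cube_def finite_horadam_strings symmetric_def sym_def
       arcs_ends_conv abs_minus_commute)

end

theory Submission
  imports Defs
begin

text \<open>Write \<open>S\<^sub>n\<close> for the strings of length \<open>n\<close>. A string of length \<open>k + m\<close> with \<open>k, m \<ge> 1\<close> either is a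
  concatenation of strings in \<open>S\<^sub>k\<close> and \<open>S\<^sub>m\<close>, or has the form \<open>w0ex\<close> with \<open>w \<in> S\<^sub>k\<^sub>-\<^sub>1\<close>, \<open>a \<le> e < a + b\<close>,
  \<open>x \<in> S\<^sub>m\<^sub>-\<^sub>1\<close>.

  Paths: with \<open>k = 1\<close>, traverse the rows \<open>a - 1, \<dots>, 0\<close> in alternating directions along a Hamiltonian
  path \<open>h\<close> of \<open>S\<^sub>n\<^sub>+\<^sub>1\<close> and then the rows \<open>0e\<close> along a Hamiltonian path \<open>g\<close> of \<open>S\<^sub>n\<close>. The two parts fit
  together, and the construction can be iterated, because \<open>h\<close> is kept of the form
  \<open>(a - 1)g\<close> followed by something.

  Cycles: take \<open>k = 1\<close> for even \<open>a\<close> and \<open>k = 2\<close> for odd \<open>a\<close>. If the number of strings is even, then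
  \<open>S\<^sub>k\<close> and \<open>S\<^sub>m\<^sub>-\<^sub>1\<close> have even size. The even number of rows gives a Hamiltonian cycle of the grid
  \<open>S\<^sub>k \<times> S\<^sub>m\<close> that contains the full first row \<open>u\<^sub>0h\<close>, where \<open>u\<^sub>0\<close> ends with \<open>0\<close>. Pairing up the vertices
  of \<open>g\<close>, one replaces every other edge \<open>u\<^sub>0(a - 1)x\<close>, \<open>u\<^sub>0(a - 1)y\<close> of that row by a detour which runs
  through all \<open>w0ex\<close> and returns through all \<open>w0ey\<close>.\<close>

section \<open>Adjacency of strings under concatenation\<close>

definition adj :: "nat list \<Rightarrow> nat list \<Rightarrow> bool" where
  "adj x y \<longleftrightarrow> length x = length y \<and> (\<Sum>i<length x. \<bar>int (x ! i) - int (y ! i)\<bar>) = 1"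

lemma adj_commute: "adj x y \<longleftrightarrow> adj y x"
  by (auto simp: adj_def abs_minus_commute)

lemma adj_Cons: "adj (c # x) (c # y) \<longleftrightarrow> adj x y"
  by (simp add: adj_def sum.lessThan_Suc_shift del: sum.lessThan_Suc)

lemma adj_append_left: "adj (u @ x) (u @ y) \<longleftrightarrow> adj x y"
  by (induction u) (auto simp: adj_Cons)

lemma adj_append_right:
  assumes "adj u v"
  shows "adj (u @ x) (v @ x)"
proof -
  have len: "length u = length v"
    using assms by (simp add: adj_def)
  have "(\<Sum>i<length u + length x. \<bar>int ((u @ x) ! i) - int ((v @ x) ! i)\<bar>) =
        (\<Sum>i<length u. \<bar>int (u ! i) - int (v ! i)\<bar>)" (is "?s = ?t")
    by (rule sum.mono_neutral_cong_right) (auto simp: nth_append len)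
  moreover have "?t = 1"
    using assms unfolding adj_def by (rule conjunct2)
  ultimately show ?thesis
    using len by (simp add: adj_def)
qed

lemma adj_singleton: "adj [c] [d] \<longleftrightarrow> d = Suc c \<or> c = Suc d"
  by (auto simp: adj_def)

lemma successively_upt: "successively (\<lambda>i j. j = Suc i) [m..<n]"
  by (auto simp: successively_conv_nth)

section \<open>Alternating traversal of a grid\<close>

text \<open>The function argument is concatenation in either order, so that the same traversal serves for
  rows with a common prefix and for rows with a common suffix.\<close>

fun zigzag :: "('a \<Rightarrow> 'b \<Rightarrow> 'c) \<Rightarrow> 'a list \<Rightarrow> 'b list \<Rightarrow> 'c list" where
  "zigzag f [] xs = []"
| "zigzag f (u # us) xs = map (f u) xs @ zigzag f us (rev xs)"

lemma set_zigzag: "set (zigzag f us xs) = {f u x | u x. u \<in> set us \<and> x \<in> set xs}"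
  by (induction us arbitrary: xs) auto

lemma length_zigzag: "length (zigzag f us xs) = length us * length xs"
  by (induction us arbitrary: xs) auto

lemma zigzag_eq_Nil_iff: "zigzag f us xs = [] \<longleftrightarrow> us = [] \<or> xs = []"
  using length_zigzag[of f us xs] by (metis length_0_conv mult_is_0)

lemma hd_zigzag: "us \<noteq> [] \<Longrightarrow> xs \<noteq> [] \<Longrightarrow> hd (zigzag f us xs) = f (hd us) (hd xs)"
  by (cases us) (auto simp: hd_map)

text \<open>Each row reverses the direction, so an even number of rows leads back to the starting
  column. This parity governs the junctions in the path and cycle constructions.\<close>

lemma last_zigzag:
  "us \<noteq> [] \<Longrightarrow> xs \<noteq> [] \<Longrightarrow>
    last (zigzag f us xs) = f (last us) (if even (length us) then hd xs else last xs)"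
proof (induction us arbitrary: xs)
  case (Cons u us)
  then show ?case
    by (cases "us = []") (auto simp: last_map last_append zigzag_eq_Nil_iff last_rev hd_rev)
qed simp

lemma distinct_zigzag:
  assumes "distinct us" "distinct xs"
    and "inj_on (\<lambda>(u, x). f u x) (set us \<times> set xs)"
  shows "distinct (zigzag f us xs)"
  using assms
proof (induction us arbitrary: xs)
  case (Cons u us)
  have "distinct (zigzag f us (rev xs))"
    using Cons.prems by (intro Cons.IH) (auto simp: inj_on_def)
  then show ?case
    using Cons.prems by (fastforce simp: distinct_map set_zigzag inj_on_def)
qed simp

lemma distinct_zigzag_append:
  assumes "distinct us" "distinct xs" "\<And>u. u \<in> set us \<Longrightarrow> length u = k"
  shows "distinct (zigzag (@) us xs)"
  using assms(1,2) by (rule distinct_zigzag) (auto simp: inj_on_def assms(3))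

text \<open>A row ends in the column where the reversed next row starts, so a change of row alters
  only the first argument of \<open>f\<close>.\<close>

lemma successively_adj_zigzag:
  assumes "successively adj us" "successively adj xs"
    and "\<And>u v x. adj u v \<Longrightarrow> adj (f u x) (f v x)"
    and "\<And>u x y. adj x y \<Longrightarrow> adj (f u x) (f u y)"
  shows "successively adj (zigzag f us xs)"
  using assms(1,2)
proof (induction us arbitrary: xs)
  case (Cons u us)
  have "successively adj (zigzag f us (rev xs))"
    using Cons.prems by (intro Cons.IH) (auto simp: successively_Cons adj_commute)
  moreover have "successively adj (map (f u) xs)"
    unfolding successively_map using Cons.prems(2) by (rule successively_mono) (rule assms(4))
  ultimately show ?case
    using Cons.prems assms(3)
    by (auto simp: successively_append_iff successively_Cons zigzag_eq_Nil_iff hd_zigzag last_map hd_rev)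
qed simp

section \<open>Decomposition of Horadam strings\<close>

lemma mem_horadam_strings_iff:
  assumes "a \<ge> 1"
  shows "x \<in> horadam_strings a b n \<longleftrightarrow>
    length x = n \<and> set x \<subseteq> {..<a + b} \<and> (x \<noteq> [] \<longrightarrow> hd x < a) \<and>
    successively (\<lambda>c d. d < a \<or> c = 0) x"
proof -
  have "(\<forall>i<length x. a \<le> x ! i \<longrightarrow> 0 < i \<and> x ! (i - 1) = 0) \<longleftrightarrow>
     (x \<noteq> [] \<longrightarrow> hd x < a) \<and> (\<forall>i. Suc i < length x \<longrightarrow> x ! Suc i < a \<or> x ! i = 0)"
    (is "?L \<longleftrightarrow> ?R")
  proof
    assume L: ?L
    show ?R
      using L[rule_format, of 0] L[rule_format, of "Suc _"] by (fastforce simp: hd_conv_nth)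
  next
    assume R: ?R
    show ?L
    proof (intro allI impI)
      fix i assume "i < length x" "a \<le> x ! i"
      then show "0 < i \<and> x ! (i - 1) = 0"
        using R by (cases i) (force simp: hd_conv_nth)+
    qed
  qed
  moreover have "(\<forall>i<length x. x ! i < a + b) \<longleftrightarrow> set x \<subseteq> {..<a + b}"
    by (auto simp: set_conv_nth)
  ultimately show ?thesis
    unfolding horadam_strings_def successively_conv_nth by auto
qed

lemma length_horadam_strings: "x \<in> horadam_strings a b n \<Longrightarrow> length x = n"
  by (simp add: horadam_strings_def)

lemma horadam_strings_0: "horadam_strings a b 0 = {[]}"
  by (auto simp: horadam_strings_def)

lemma horadam_strings_Suc_0:
  assumes "a \<ge> 1"
  shows "horadam_strings a b (Suc 0) = {[c] | c. c < a}"
  by (auto simp: mem_horadam_strings_iff[OF assms] length_Suc_conv)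

text \<open>Cut after \<open>Suc k\<close> letters. The right piece is a valid string unless its
  first letter \<open>e\<close> is at least \<open>a\<close>, and then the letter before the cut is
  \<open>0\<close>. As \<open>e\<close> is not \<open>0\<close>, a letter after \<open>e\<close> is
  again below \<open>a\<close>, so what follows is a valid string.\<close>

lemma horadam_strings_add:
  assumes "a \<ge> 1"
  shows "horadam_strings a b (Suc k + Suc m) =
    {u @ x | u x. u \<in> horadam_strings a b (Suc k) \<and> x \<in> horadam_strings a b (Suc m)} \<union>
    {w @ [0, e] @ x | w e x. w \<in> horadam_strings a b k \<and> e \<in> {a..<a + b} \<and>
       x \<in> horadam_strings a b m}" (is "?L = ?A \<union> ?B")
proof
  note mem = mem_horadam_strings_iff[OF assms]
  show "?L \<subseteq> ?A \<union> ?B"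
  proof
    fix s assume s: "s \<in> ?L"
    define u x where "u = take (Suc k) s" and "x = drop (Suc k) s"
    have ux: "s = u @ x" "length u = Suc k" "length x = Suc m"
      using length_horadam_strings[OF s] by (auto simp: u_def x_def)
    show "s \<in> ?A \<union> ?B"
    proof (cases "hd x < a")
      case True
      then have "u \<in> horadam_strings a b (Suc k)" "x \<in> horadam_strings a b (Suc m)"
        using s ux by (auto simp: mem successively_append_iff split: if_splits)
      then show ?thesis using ux by blast
    next
      case False
      obtain w c where u: "u = w @ [c]" using ux(2) by (cases u rule: rev_cases) auto
      obtain e x' where x: "x = e # x'" using ux(3) by (cases x) auto
      have "c = 0" "w \<in> horadam_strings a b k" "e \<in> {a..<a + b}" "x' \<in> horadam_strings a b m"
        using s ux False assms unfolding u x
        by (auto simp: mem successively_append_iff successively_Cons hd_append split: if_splits)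
      then show ?thesis using ux unfolding u x by auto
    qed
  qed
  show "?A \<union> ?B \<subseteq> ?L"
    using assms
    by (auto simp: mem successively_append_iff successively_Cons hd_append subset_iff split: if_splits)
qed

section \<open>Hamiltonian paths as lists\<close>

definition hamiltonian_list :: "nat list set \<Rightarrow> nat list list \<Rightarrow> bool" where
  "hamiltonian_list V l \<longleftrightarrow> distinct l \<and> set l = V \<and> successively adj l"

lemma hamiltonian_list_rev: "hamiltonian_list V l \<Longrightarrow> hamiltonian_list V (rev l)"
  by (simp add: hamiltonian_list_def adj_commute)

lemma hamiltonian_list_length: "hamiltonian_list V l \<Longrightarrow> length l = card V"
  by (auto simp: hamiltonian_list_def distinct_card)

lemma replicate_in_horadam_strings: "a \<ge> 1 \<Longrightarrow> replicate n 0 \<in> horadam_strings a b n"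
  by (simp add: horadam_strings_def)

lemma hamiltonian_list_nonempty:
  "a \<ge> 1 \<Longrightarrow> hamiltonian_list (horadam_strings a b n) l \<Longrightarrow> l \<noteq> []"
  using replicate_in_horadam_strings[of a n b] by (auto simp: hamiltonian_list_def)

lemma hamiltonian_list_horadam_0: "hamiltonian_list (horadam_strings a b 0) [[]]"
  by (simp add: hamiltonian_list_def horadam_strings_0)

lemma hamiltonian_list_horadam_Suc_0:
  assumes "a \<ge> 1"
  shows "hamiltonian_list (horadam_strings a b (Suc 0)) (map (\<lambda>c. [c]) [0..<a])"
  unfolding hamiltonian_list_def successively_map horadam_strings_Suc_0[OF assms]
  by (auto simp: distinct_map inj_on_def adj_singleton intro: successively_mono[OF successively_upt])

text \<open>The direction of \<open>h\<close> is chosen so that, after \<open>a\<close> rows, the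
  first block ends at \<open>0 # hd h\<close>.\<close>

definition next_list :: "nat \<Rightarrow> nat \<Rightarrow> nat list list \<Rightarrow> nat list list \<Rightarrow> nat list list" where
  "next_list a b g h =
     zigzag (@) (map (\<lambda>c. [c]) (rev [0..<a])) (if even a then h else rev h) @
     zigzag (@) (map (\<lambda>e. [0, e]) [a..<a + b]) g"

lemma successively_adj_tail: "successively adj (map (\<lambda>e. [0, e]) [a..<c])"
  unfolding successively_map
  by (auto simp: adj_Cons adj_singleton intro: successively_mono[OF successively_upt])

text \<open>By \<open>hg\<close> the first block ends at \<open>0 # (a - 1) # hd g\<close>, and
  raising \<open>a - 1\<close> to \<open>a\<close> gives the start of the second block. The second
  conclusion supplies \<open>hg\<close> for the next length.\<close>

lemma hamiltonian_list_next:
  assumes a: "a \<ge> 1" and b: "b \<ge> 1"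
    and g: "hamiltonian_list (horadam_strings a b n) g"
    and h: "hamiltonian_list (horadam_strings a b (Suc n)) h"
    and hg: "h = map ((#) (a - 1)) g @ r"
  shows "hamiltonian_list (horadam_strings a b (Suc (Suc n))) (next_list a b g h)"
    and "\<exists>r. next_list a b g h = map ((#) (a - 1)) (if even a then h else rev h) @ r"
proof -
  define h' where "h' = (if even a then h else rev h)"
  define us where "us = map (\<lambda>c. [c]) (rev [0..<a])"
  define ts where "ts = map (\<lambda>e. [0, e]) [a..<a + b]"
  have L: "next_list a b g h = zigzag (@) us h' @ zigzag (@) ts g"
    by (simp add: next_list_def h'_def us_def ts_def)
  obtain a' where a': "a = Suc a'" using a by (cases a) auto
  have us_Cons: "us = [a - 1] # map (\<lambda>c. [c]) (rev [0..<a - 1])"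
    by (simp add: us_def a')
  show "\<exists>r. next_list a b g h = map ((#) (a - 1)) h' @ r"
    unfolding L us_Cons by auto
  have ne: "g \<noteq> []" "h' \<noteq> []" "us \<noteq> []" "ts \<noteq> []"
    using hamiltonian_list_nonempty[OF a] g h a b by (auto simp: us_def ts_def h'_def)
  have h': "hamiltonian_list (horadam_strings a b (Suc n)) h'"
    using h by (auto simp: h'_def hamiltonian_list_rev)
  have us: "hamiltonian_list (horadam_strings a b (Suc 0)) us"
    unfolding us_def rev_map[symmetric]
    by (intro hamiltonian_list_rev hamiltonian_list_horadam_Suc_0 a)
  have hd_h: "hd h = (a - 1) # hd g"
    using ne by (simp add: hg hd_map hd_append)
  have last_us: "last us = [0]"
    using a by (simp add: us_def last_map last_rev)
  have last1: "last (zigzag (@) us h') = 0 # hd h"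
    using ne last_us by (auto simp: last_zigzag h'_def us_def last_rev)
  have hd2: "hd (zigzag (@) ts g) = 0 # a # hd g"
    using ne b by (simp add: hd_zigzag ts_def hd_map)
  have "successively adj (zigzag (@) us h')"
    using us h' by (intro successively_adj_zigzag)
      (auto simp: hamiltonian_list_def adj_append_left adj_append_right)
  moreover have "successively adj (zigzag (@) ts g)"
    using g by (intro successively_adj_zigzag)
      (auto simp: hamiltonian_list_def adj_append_left adj_append_right ts_def successively_adj_tail)
  moreover have "adj ((a - 1) # hd g) (a # hd g)"
    using adj_append_right[of "[a - 1]" "[a]"] a by (simp add: adj_singleton)
  ultimately have succ: "successively adj (next_list a b g h)"
    unfolding L by (simp add: successively_append_iff last1 hd2 hd_h adj_Cons)
  \<comment> \<open>Writing the length as \<open>Suc 0 + Suc n\<close> selects the cut after the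
    first letter, where the prefix \<open>w\<close> is empty.\<close>
  have "set (next_list a b g h) = horadam_strings a b (Suc 0 + Suc n)"
    unfolding horadam_strings_add[OF a] L set_append set_zigzag
    using us h' g by (force simp: hamiltonian_list_def horadam_strings_0 ts_def)
  moreover have "distinct (next_list a b g h)"
  proof -
    \<comment> \<open>The second letter tells the two blocks apart: it is below \<open>a\<close> in
      the first and at least \<open>a\<close> in the second.\<close>
    have hd_h': "hd x < a" "x \<noteq> []" if "x \<in> set h'" for x
      using that h' by (auto simp: hamiltonian_list_def mem_horadam_strings_iff[OF a])
    have "distinct (zigzag (@) us h')"
      using us h' by (intro distinct_zigzag_append[where k = "Suc 0"])
        (auto simp: hamiltonian_list_def length_horadam_strings)
    moreover have "distinct (zigzag (@) ts g)"
      using g by (intro distinct_zigzag_append[where k = 2])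
        (auto simp: hamiltonian_list_def ts_def inj_on_def distinct_map)
    moreover have "set (zigzag (@) us h') \<inter> set (zigzag (@) ts g) = {}"
      using hd_h' by (fastforce simp: set_zigzag us_def ts_def)
    ultimately show ?thesis
      unfolding L by simp
  qed
  ultimately show "hamiltonian_list (horadam_strings a b (Suc (Suc n))) (next_list a b g h)"
    using succ by (simp add: hamiltonian_list_def)
qed

text \<open>The induction step passes from the lists for \<open>n\<close> and \<open>Suc n\<close>
  to the list for \<open>Suc n\<close>, reversed when \<open>a\<close> is odd, and
  \<open>next_list\<close>.\<close>

lemma ex_hamiltonian_lists:
  assumes "a \<ge> 1" "b \<ge> 1"
  shows "\<exists>g r. hamiltonian_list (horadam_strings a b n) g \<and>
    hamiltonian_list (horadam_strings a b (Suc n)) (map ((#) (a - 1)) g @ r)"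
proof (induction n)
  case 0
  have "hamiltonian_list (horadam_strings a b (Suc 0)) (map (\<lambda>c. [c]) (rev [0..<a]))"
    unfolding rev_map[symmetric]
    by (intro hamiltonian_list_rev hamiltonian_list_horadam_Suc_0 assms)
  moreover have "map (\<lambda>c. [c]) (rev [0..<a]) =
      map ((#) (a - 1)) [[]] @ map (\<lambda>c. [c]) (rev [0..<a - 1])"
    using assms by (cases a) auto
  ultimately show ?case
    using hamiltonian_list_horadam_0 by metis
next
  case (Suc n)
  then obtain g r where g: "hamiltonian_list (horadam_strings a b n) g"
    and h: "hamiltonian_list (horadam_strings a b (Suc n)) (map ((#) (a - 1)) g @ r)"
    by blast
  define h' where "h' = (if even a then map ((#) (a - 1)) g @ r else rev (map ((#) (a - 1)) g @ r))"
  have "hamiltonian_list (horadam_strings a b (Suc n)) h'"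
    using h hamiltonian_list_rev[OF h] by (simp only: h'_def split: if_split) simp
  moreover obtain r' where "next_list a b g (map ((#) (a - 1)) g @ r) = map ((#) (a - 1)) h' @ r'"
    using hamiltonian_list_next(2)[OF assms g h refl] unfolding h'_def by blast
  ultimately show ?case
    using hamiltonian_list_next(1)[OF assms g h refl] by (auto simp del: rev_append)
qed

text \<open>Counts the entries of \<open>next_list\<close>: \<open>a\<close> rows as long as
  \<open>h\<close> and \<open>b\<close> rows as long as \<open>g\<close>.\<close>

lemma card_horadam_strings:
  assumes "a \<ge> 1" "b \<ge> 1"
  shows "card (horadam_strings a b (Suc (Suc n))) =
    a * card (horadam_strings a b (Suc n)) + b * card (horadam_strings a b n)"
proof -
  obtain g r where g: "hamiltonian_list (horadam_strings a b n) g"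
    and h: "hamiltonian_list (horadam_strings a b (Suc n)) (map ((#) (a - 1)) g @ r)"
    using ex_hamiltonian_lists[OF assms] by blast
  show ?thesis
    using hamiltonian_list_next(1)[OF assms g h refl] g h
    by (auto simp: hamiltonian_list_length[symmetric] next_list_def length_zigzag)
qed

section \<open>Hamiltonian cycles as lists\<close>

definition hamiltonian_cycle_list :: "nat list set \<Rightarrow> nat list list \<Rightarrow> bool" where
  "hamiltonian_cycle_list V l \<longleftrightarrow> hamiltonian_list V l \<and> adj (last l) (hd l) \<and> 3 \<le> length l"

text \<open>Here \<open>us\<close> enumerates the rows of the grid and \<open>q\<close> the prefixes
  \<open>w\<close> of the detours. The condition \<open>hd_us\<close> lets the detours branch off
  the first row; the even lengths of \<open>us\<close> and \<open>g\<close> close the grid cycle and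
  the detours.\<close>

lemma ex_hamiltonian_cycle_list:
  assumes a: "a \<ge> 1" and b: "b \<ge> 1"
    and us: "hamiltonian_list (horadam_strings a b (Suc k)) us" and even_us: "even (length us)"
    and q: "hamiltonian_list (horadam_strings a b k) q" and hd_us: "hd us = hd q @ [0]"
    and g: "hamiltonian_list (horadam_strings a b m) g" and even_g: "even (length g)"
    and h: "hamiltonian_list (horadam_strings a b (Suc m)) h"
    and hg: "h = map ((#) (a - 1)) g @ r"
  shows "\<exists>l. hamiltonian_cycle_list (horadam_strings a b (Suc k + Suc m)) l"
proof -
  obtain u0 us' where us_Cons: "us = u0 # us'"
    using hamiltonian_list_nonempty[OF a us] by (cases us) auto
  obtain x0 h' where h_Cons: "h = x0 # h'"
    using hamiltonian_list_nonempty[OF a h] by (cases h) auto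
  have u0: "u0 = hd q @ [0]"
    using hd_us us_Cons by simp
  define ts where "ts = map (\<lambda>e. [0, e]) [a..<a + b]"
  \<comment> \<open>One half of a detour, with the suffix from \<open>g\<close> still to be
    appended: it starts in the first row and visits all \<open>w @ [0, e]\<close>.\<close>
  define zs where "zs = (u0 @ [a - 1]) # zigzag (@) q ts"
  \<comment> \<open>\<open>A\<close> is the initial segment \<open>u0 @ (a - 1) # g\<close> of the first row with all its detours, \<open>B\<close> the rest
    of this row, \<open>C\<close> the other rows without their first column, and \<open>D\<close> the way back through this column.\<close>
  define A where "A = zigzag (\<lambda>x z. z @ x) g zs"
  define B where "B = map (\<lambda>x. u0 @ x) r"
  define C where "C = zigzag (@) us' (rev h')"
  define D where "D = map (\<lambda>u. u @ x0) (rev us')"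
  have ne: "g \<noteq> []" "q \<noteq> []" "us' \<noteq> []" "ts \<noteq> []" "zs \<noteq> []"
    using hamiltonian_list_nonempty[OF a] g q even_us b by (auto simp: us_Cons ts_def zs_def)
  have "length g \<ge> 2"
    using ne(1) even_g by (cases g; cases "tl g") auto
  then have "length h \<ge> 2"
    by (simp add: hg)
  then have h'_ne: "h' \<noteq> []"
    by (auto simp: h_Cons)
  have x0: "x0 = (a - 1) # hd g"
    using ne(1) h_Cons hg by (cases g) auto

  have adj_us: "adj u0 (hd us')" "successively adj us'"
    using us ne(3) by (auto simp: us_Cons hamiltonian_list_def successively_Cons)
  have adj_h: "adj x0 (hd h')" "successively adj h'"
    using h h'_ne by (auto simp: h_Cons hamiltonian_list_def successively_Cons)
  have succ_zs: "successively adj zs"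
  proof -
    have "successively adj (zigzag (@) q ts)"
      using q by (intro successively_adj_zigzag)
        (auto simp: hamiltonian_list_def adj_append_left adj_append_right ts_def successively_adj_tail)
    moreover have "hd (zigzag (@) q ts) = hd q @ [0, a]"
      using ne b by (simp add: hd_zigzag ts_def hd_map)
    moreover have "adj (u0 @ [a - 1]) (hd q @ [0, a])"
      using a by (simp add: u0 adj_append_left adj_Cons adj_singleton)
    ultimately show ?thesis
      by (simp add: zs_def successively_Cons)
  qed
  have succ_A: "successively adj A"
    unfolding A_def using g succ_zs
    by (intro successively_adj_zigzag)
      (auto simp: hamiltonian_list_def adj_append_left adj_append_right)
  \<comment> \<open>As \<open>length g\<close> is even, the last copy of \<open>zs\<close> is
    traversed backwards and the walk is back in the row \<open>u0\<close>.\<close>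
  have A: "A \<noteq> []" "hd A = u0 @ x0" "last A = u0 @ (a - 1) # last g"
    using ne even_g by (auto simp: A_def zigzag_eq_Nil_iff hd_zigzag last_zigzag zs_def x0)
  have AB: "successively adj (A @ B)" "hd (A @ B) = u0 @ x0" "last (A @ B) = u0 @ last h'"
  proof -
    have "last h = last h'"
      using h'_ne by (simp add: h_Cons)
    then show "last (A @ B) = u0 @ last h'"
      using A ne(1) by (cases "r = []") (auto simp: B_def hg last_map)
    show "hd (A @ B) = u0 @ x0"
      using A by simp
    have "successively adj h"
      using h by (simp add: hamiltonian_list_def)
    then have "successively adj r" "r \<noteq> [] \<Longrightarrow> adj ((a - 1) # last g) (hd r)"
      using ne(1) by (auto simp: hg successively_append_iff last_map)
    then show "successively adj (A @ B)"
      using succ_A A by (cases "r = []")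
        (auto simp: successively_append_iff B_def successively_map adj_append_left hd_map)
  qed
  have succ_C: "successively adj C"
    unfolding C_def using adj_us adj_h
    by (intro successively_adj_zigzag) (auto simp: adj_append_left adj_append_right adj_commute)
  \<comment> \<open>The length of \<open>us'\<close> is odd, so the zigzag through
    \<open>rev h'\<close> ends in the column \<open>hd h'\<close>, next to
    \<open>x0\<close>.\<close>
  have C: "C \<noteq> []" "hd C = hd us' @ last h'" "last C = last us' @ hd h'"
    using ne h'_ne even_us
    by (auto simp: C_def us_Cons zigzag_eq_Nil_iff hd_zigzag last_zigzag hd_rev last_rev)
  have succ_D: "successively adj D"
    unfolding D_def successively_map using adj_us(2)
    by (auto intro!: adj_append_right elim!: successively_mono simp: adj_commute)
  have D: "D \<noteq> []" "hd D = last us' @ x0" "last D = hd us' @ x0"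
    using ne by (auto simp: D_def hd_map hd_rev last_map last_rev)

  \<comment> \<open>At the junctions \<open>A @ B\<close> to \<open>C\<close> and \<open>D\<close>
    back to \<open>A\<close>, only the row changes, between \<open>u0\<close> and
    \<open>hd us'\<close>; from \<open>C\<close> to \<open>D\<close> only the column changes, from
    \<open>hd h'\<close> to \<open>x0\<close>.\<close>
  define l where "l = (A @ B) @ C @ D"
  have succ_l: "successively adj l"
    unfolding l_def successively_append_iff[of _ "A @ B"] successively_append_iff[of _ C]
    using AB C D succ_C succ_D adj_us(1) adj_h(1) A(1)
    by (auto simp: adj_append_left adj_append_right adj_commute)
  have closed: "adj (last l) (hd l)"
    using AB(2) A D adj_us(1) by (auto simp: l_def adj_append_right adj_commute)
  have set_zs:
    "set zs = insert (u0 @ [a - 1]) (\<Union>w\<in>set q. (\<lambda>e. w @ [0, e]) ` {a..<a + b})"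
    by (auto simp: zs_def set_zigzag ts_def)
  have mem_A: "y \<in> set A \<longleftrightarrow> (\<exists>x\<in>set g. y = u0 @ (a - 1) # x) \<or>
      (\<exists>w\<in>set q. \<exists>e\<in>{a..<a + b}. \<exists>x\<in>set g. y = w @ 0 # e # x)" for y
  proof -
    have "y \<in> set A \<longleftrightarrow> (\<exists>z\<in>set zs. \<exists>x\<in>set g. y = z @ x)"
      by (auto simp: A_def set_zigzag)
    then show ?thesis
      unfolding set_zs by simp
  qed
  have mem_B: "y \<in> set B \<longleftrightarrow> (\<exists>x\<in>set r. y = u0 @ x)" for y
    by (auto simp: B_def)
  have mem_C: "y \<in> set C \<longleftrightarrow> (\<exists>u\<in>set us'. \<exists>x\<in>set h'. y = u @ x)" for y
    by (auto simp: C_def set_zigzag)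
  have mem_D: "y \<in> set D \<longleftrightarrow> (\<exists>u\<in>set us'. y = u @ x0)" for y
    by (auto simp: D_def)
  have set_h: "set h = (#) (a - 1) ` set g \<union> set r"
    by (simp add: hg)
  have "set l = horadam_strings a b (Suc k + Suc m)"
  proof -
    have "y \<in> set l \<longleftrightarrow> (\<exists>u\<in>set us. \<exists>x\<in>set h. y = u @ x) \<or>
      (\<exists>w\<in>set q. \<exists>e\<in>{a..<a + b}. \<exists>x\<in>set g. y = w @ 0 # e # x)" for y
    proof -
      have AB: "y \<in> set A \<or> y \<in> set B \<longleftrightarrow> (\<exists>x\<in>set h. y = u0 @ x) \<or>
          (\<exists>w\<in>set q. \<exists>e\<in>{a..<a + b}. \<exists>x\<in>set g. y = w @ 0 # e # x)"
        unfolding mem_A mem_B set_h by blast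
      have CD: "y \<in> set C \<or> y \<in> set D \<longleftrightarrow> (\<exists>u\<in>set us'. \<exists>x\<in>set h. y = u @ x)"
        unfolding mem_C mem_D h_Cons by auto
      show ?thesis
        unfolding l_def us_Cons set_append Un_iff AB CD list.set bex_simps by (simp only: disj_ac)
    qed
    then have "set l = {u @ x | u x. u \<in> set us \<and> x \<in> set h} \<union>
        {w @ [0, e] @ x | w e x. w \<in> set q \<and> e \<in> {a..<a + b} \<and> x \<in> set g}"
      by (simp add: set_eq_iff Bex_def; blast)
    then show ?thesis
      using us q g h unfolding horadam_strings_add[OF a] hamiltonian_list_def by simp
  qed
  moreover have "distinct l"
  proof -
    have dist: "distinct h" "distinct us" "distinct q" "distinct g"
      using h us q g by (auto simp: hamiltonian_list_def)
    have len_us: "length u = Suc k" if "u \<in> set us" for u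
      using that us by (auto simp: hamiltonian_list_def length_horadam_strings)
    have len_q: "length w = k" if "w \<in> set q" for w
      using that q by (auto simp: hamiltonian_list_def length_horadam_strings)
    have eq_us: "u @ x = v @ y \<longleftrightarrow> u = v \<and> x = y" if "u \<in> set us" "v \<in> set us" for u v x y
      using len_us that by simp
    \<comment> \<open>Comparing what follows the first \<open>Suc k\<close> letters would give
      \<open>y = e # x\<close>, but strings in \<open>h\<close> begin with a letter below
      \<open>a\<close>.\<close>
    have neq: "w @ 0 # e # x \<noteq> u @ y"
      if "w \<in> set q" "u \<in> set us" "y \<in> set h" "e \<in> {a..<a + b}" for w u x y e
    proof
      assume "w @ 0 # e # x = u @ y"
      then have "(w @ [0]) @ (e # x) = u @ y"
        by simp
      moreover have "length (w @ [0]) = length u"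
        using len_us len_q that by simp
      ultimately have "y = e # x"
        using append_eq_append_conv by blast
      then show False
        using that h by (auto simp: hamiltonian_list_def mem_horadam_strings_iff[OF a])
    qed
    have "distinct (zigzag (@) q ts)"
      using dist len_q by (intro distinct_zigzag_append) (auto simp: ts_def inj_on_def distinct_map)
    moreover have "u0 @ [a - 1] \<notin> set (zigzag (@) q ts)"
      using a by (auto simp: set_zigzag ts_def u0)
    ultimately have "distinct zs"
      by (simp add: zs_def)
    moreover have "length z = Suc (Suc k)" if "z \<in> set zs" for z
      using that len_q len_us[of u0] by (auto simp: set_zs us_Cons)
    ultimately have "distinct A"
      unfolding A_def using dist by (intro distinct_zigzag) (auto simp: inj_on_def)
    moreover have "distinct B" "distinct D"
      using dist len_us by (auto simp: B_def D_def hg us_Cons distinct_map inj_on_def)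
    moreover have "distinct C"
      unfolding C_def using dist len_us
      by (intro distinct_zigzag_append[where k = "Suc k"]) (auto simp: h_Cons us_Cons)
    moreover have "y \<notin> set B" if yA: "y \<in> set A" for y
    proof
      assume "y \<in> set B"
      then obtain x where x: "x \<in> set r" "y = u0 @ x"
        unfolding mem_B by blast
      have "y \<noteq> w @ 0 # e # x'" if "w \<in> set q" "e \<in> {a..<a + b}" for w e x'
        using neq[OF that(1) _ _ that(2), of u0 x x'] x by (simp add: set_h us_Cons eq_commute)
      then obtain x' where "x' \<in> set g" "y = u0 @ (a - 1) # x'"
        using yA unfolding mem_A by blast
      then show False
        using x dist(1) by (auto simp: hg)
    qed
    moreover have "y \<notin> set D" if "y \<in> set C" for y
      using that dist eq_us by (auto simp: mem_C mem_D us_Cons h_Cons)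
    moreover have "y \<notin> set A \<and> y \<notin> set B" if yCD: "y \<in> set C \<or> y \<in> set D" for y
    proof -
      obtain u x where ux: "y = u @ x" "u \<in> set us'" "x \<in> set h"
        using yCD unfolding mem_C mem_D h_Cons by auto
      then have "u \<noteq> u0" "u \<in> set us" "u0 \<in> set us"
        using dist by (auto simp: us_Cons)
      then show ?thesis
        using eq_us[of u u0] neq[of _ u x] ux unfolding mem_A mem_B by metis
    qed
    ultimately show ?thesis
      unfolding l_def distinct_append set_append by blast
  qed
  moreover have "3 \<le> length l"
  proof -
    have "length A \<ge> 2"
      using \<open>length g \<ge> 2\<close> by (simp add: A_def length_zigzag zs_def)
    then show ?thesis
      using D(1) by (cases D) (auto simp: l_def)
  qed
  ultimately show ?thesis
    unfolding hamiltonian_cycle_list_def hamiltonian_list_def using succ_l closed by blast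
qed

section \<open>Parity of the number of strings\<close>

text \<open>Modulo 2 the recurrence keeps the previous value, and both initial values are odd. This
  excludes even \<open>b\<close> when \<open>a\<close> is odd and the number of strings is
  even.\<close>

lemma odd_card_horadam_strings:
  assumes "a \<ge> 1" "b \<ge> 1" "odd a" "even b"
  shows "odd (card (horadam_strings a b n))"
proof -
  have "odd (card (horadam_strings a b n)) \<and> odd (card (horadam_strings a b (Suc n)))"
  proof (induction n)
    case 0
    show ?case
      using hamiltonian_list_length[OF hamiltonian_list_horadam_Suc_0[OF assms(1)], of b] assms
      by (auto simp: horadam_strings_0)
  next
    case (Suc n)
    then show ?case
      using card_horadam_strings[OF assms(1,2), of n] assms by simp
  qed
  then show ?thesis ..
qed

text \<open>Both coefficients of the recurrence are even; length 0 is left out because there is one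
  empty string.\<close>

lemma even_card_horadam_strings:
  assumes "a \<ge> 1" "b \<ge> 1" "even a" "even b"
  shows "even (card (horadam_strings a b (Suc n)))"
proof (cases n)
  case 0
  then show ?thesis
    using hamiltonian_list_length[OF hamiltonian_list_horadam_Suc_0[OF assms(1)], of b] assms by simp
next
  case (Suc n')
  then show ?thesis
    using card_horadam_strings[OF assms(1,2), of n'] assms by simp
qed

lemma ex_hamiltonian_cycle_list_horadam:
  assumes a: "a \<ge> 1" and b: "b \<ge> 1" and n: "n > 2" and ev: "even (card (horadam_strings a b n))"
  shows "\<exists>l. hamiltonian_cycle_list (horadam_strings a b n) l"
proof -
  obtain n' where n': "n = Suc (Suc (Suc n'))"
    using n by (intro that[of "n - 3"]) simp
  note card = card_horadam_strings[OF a b]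
  show ?thesis
  proof (cases "even a")
    case True
    \<comment> \<open>For odd \<open>b\<close> this follows from \<open>ev\<close> and the
      recurrence, for even \<open>b\<close> from the preceding lemma.\<close>
    have "even (card (horadam_strings a b (Suc n')))"
      using ev True even_card_horadam_strings[OF a b True] by (auto simp: n' card[of "Suc n'"])
    moreover obtain g r where g: "hamiltonian_list (horadam_strings a b (Suc n')) g"
      and h: "hamiltonian_list (horadam_strings a b (Suc (Suc n'))) (map ((#) (a - 1)) g @ r)"
      using ex_hamiltonian_lists[OF a b] by blast
    moreover have "hd (map (\<lambda>c. [c]) [0..<a]) = hd [[]] @ [0]"
      using a by (simp add: hd_map)
    ultimately show ?thesis
      using ex_hamiltonian_cycle_list[OF a b hamiltonian_list_horadam_Suc_0[OF a] _
          hamiltonian_list_horadam_0 _ g _ h refl] True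
      by (simp add: n' hamiltonian_list_length[OF g])
  next
    case False
    then have "odd b"
      using odd_card_horadam_strings[OF a b] ev by blast
    \<comment> \<open>With \<open>a\<close> and \<open>b\<close> odd the recurrence is that of
      Fibonacci modulo 2, so parity has period 3 in the length.\<close>
    have "even (card (horadam_strings a b n'))"
      using ev False \<open>odd b\<close> by (auto simp: n' card[of "Suc n'"] card[of n'])
    moreover obtain g r where g: "hamiltonian_list (horadam_strings a b n') g"
      and h: "hamiltonian_list (horadam_strings a b (Suc n')) (map ((#) (a - 1)) g @ r)"
      using ex_hamiltonian_lists[OF a b] by blast
    \<comment> \<open>The descending order gives \<open>hd q = [a - 1]\<close>. For odd
      \<open>a\<close> the first row of \<open>next_list\<close> runs through \<open>rev q\<close>,
      so \<open>us\<close> starts with \<open>[a - 1, 0]\<close>, as \<open>hd_us\<close>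
      demands.\<close>
    moreover define q where "q = rev (map (\<lambda>c. [c]) [0..<a])"
    have q: "hamiltonian_list (horadam_strings a b (Suc 0)) q"
      unfolding q_def by (intro hamiltonian_list_rev hamiltonian_list_horadam_Suc_0 a)
    have q_Cons: "q = map ((#) (a - 1)) [[]] @ rev (map (\<lambda>c. [c]) [0..<a - 1])"
      using a by (cases a) (auto simp: q_def)
    define us where "us = next_list a b [[]] q"
    have us: "hamiltonian_list (horadam_strings a b (Suc (Suc 0))) us"
      unfolding us_def
      by (rule hamiltonian_list_next(1)[OF a b hamiltonian_list_horadam_0 q q_Cons])
    have "hd us = hd q @ [0]"
    proof -
      obtain r' where "us = map ((#) (a - 1)) (rev q) @ r'"
        using hamiltonian_list_next(2)[OF a b hamiltonian_list_horadam_0 q q_Cons] False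
        by (auto simp: us_def)
      then show ?thesis
        using a q_Cons by (cases a) (auto simp: q_def hd_append hd_map upt_rec)
    qed
    \<comment> \<open>The length is \<open>a * a + b\<close>, a sum of two odd numbers.\<close>
    moreover have "even (length us)"
      using False \<open>odd b\<close> by (simp add: us_def next_list_def length_zigzag q_def)
    ultimately show ?thesis
      using ex_hamiltonian_cycle_list[OF a b us _ q _ g _ h refl]
      by (simp add: n' hamiltonian_list_length[OF g])
  qed
qed

section \<open>From vertex lists to walks in the cube\<close>

lemma pawalk_verts_vwalk_arcs: "pawalk_verts u (vwalk_arcs (u # xs)) = u # xs"
  by (induction xs arbitrary: u) auto

lemma pcas_vwalk_arcs: "pcas u (vwalk_arcs (u # xs)) (last (u # xs))"
  by (induction xs arbitrary: u) auto

lemma fst_vwalk_arcs: "map fst (vwalk_arcs xs) = butlast xs"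
  by (induction xs rule: vwalk_arcs.induct) auto

lemma set_vwalk_arcs_subset_parcs:
  assumes "successively adj l" "set l \<subseteq> horadam_strings a b n"
  shows "set (vwalk_arcs l) \<subseteq> parcs (horadam_cube a b n)"
  using assms
  by (induction l rule: vwalk_arcs.induct)
    (auto simp: horadam_cube_def adj_def dest: length_horadam_strings)

lemma awalk_vwalk_arcs:
  assumes "successively adj (u # xs)" "set (u # xs) \<subseteq> horadam_strings a b n"
  shows "pre_digraph.awalk (with_proj (horadam_cube a b n)) u (vwalk_arcs (u # xs)) (last (u # xs))"
  unfolding pre_digraph.awalk_def cas_with_proj_eq
  using set_vwalk_arcs_subset_parcs[OF assms] pcas_vwalk_arcs[of u xs] assms(2)
  by (simp add: horadam_cube_def del: vwalk_arcs_Cons last.simps)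

theorem corollary3:
  fixes a b n :: nat
  assumes "a \<ge> 1" and "b \<ge> 1" and "n \<ge> 1"
  shows "(\<exists>u p v. hamiltonian_path (with_proj (horadam_cube a b n)) u p v) \<and>
         (n > 2 \<and> even (card (pverts (horadam_cube a b n))) \<longrightarrow>
            hamiltonian (with_proj (horadam_cube a b n)))"
proof (intro conjI impI)
  obtain g where g: "hamiltonian_list (horadam_strings a b n) g"
    using ex_hamiltonian_lists[OF assms(1,2)] by blast
  obtain u xs where uxs: "g = u # xs"
    using hamiltonian_list_nonempty[OF assms(1) g] by (cases g) auto
  have "hamiltonian_path (with_proj (horadam_cube a b n)) u (vwalk_arcs (u # xs)) (last (u # xs))"
    unfolding hamiltonian_path_def pre_digraph.apath_def awalk_verts_with_proj_eq
      pawalk_verts_vwalk_arcs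
    using g awalk_vwalk_arcs[of u xs a b n]
    by (simp add: hamiltonian_list_def uxs horadam_cube_def del: vwalk_arcs_Cons)
  then show "\<exists>u p v. hamiltonian_path (with_proj (horadam_cube a b n)) u p v"
    by blast
next
  assume n: "n > 2 \<and> even (card (pverts (horadam_cube a b n)))"
  then obtain l where l: "hamiltonian_cycle_list (horadam_strings a b n) l"
    using ex_hamiltonian_cycle_list_horadam[OF assms(1,2), of n] by (auto simp: horadam_cube_def)
  then obtain u xs where uxs: "l = u # xs"
    by (cases l) (auto simp: hamiltonian_cycle_list_def)
  \<comment> \<open>Repeating \<open>u\<close> at the end adds the closing arc, and the tails of the
    arcs are then exactly \<open>u # xs\<close>.\<close>
  define p where "p = vwalk_arcs (u # xs @ [u])"
  have tail: "map fst p = u # xs"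
    by (simp add: p_def fst_vwalk_arcs butlast_append del: vwalk_arcs_Cons)
  have l': "distinct (u # xs)" "set (u # xs) = horadam_strings a b n" "successively adj (u # xs)"
    "adj (last (u # xs)) u" "3 \<le> length (u # xs)"
    using l by (auto simp: uxs hamiltonian_cycle_list_def hamiltonian_list_def)
  have "successively adj ((u # xs) @ [u])"
    unfolding successively_append_iff using l' by simp
  then have "pre_digraph.awalk (with_proj (horadam_cube a b n)) u p u"
    using awalk_vwalk_arcs[of u "xs @ [u]" a b n] l'(2) by (auto simp add: p_def simp del: vwalk_arcs_Cons)
  moreover have "pawalk_verts u p = u # xs @ [u]"
    unfolding p_def by (rule pawalk_verts_vwalk_arcs)
  moreover have "3 \<le> length p"
    using l'(5) arg_cong[OF tail, of length] by simp
  moreover have "fst ` set p = horadam_strings a b n"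
    using l'(2) tail by (metis set_map)
  ultimately show "hamiltonian (with_proj (horadam_cube a b n))"
    unfolding hamiltonian_def pre_digraph.cycle_def awalk_verts_with_proj_eq using l'(1)
    by (intro exI[of _ p] conjI exI[of _ u]) (auto simp: horadam_cube_def)
qed

end
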